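(* Let $G$ be a finite simple connected graph. If the complement $\overline{G}$ is triangle-free and $\operatorname{diam}(\overline{G})=2$, then $pc_{1,2}(G)\leq 3$.
   Context: All graphs are finite, undirected and simple. An edge-coloring is an arbitrary map from the edge set to a set of colors (adjacent edges may receive the same color). In an edge-colored graph, a path $P$ is a distance $2$-proper path if no two edges of $P$ of the same color appear with fewer than $2$ edges in between on $P$; equivalently, any two distinct edges of $P$ that are consecutive on $P$ or separated by exactly one edge of $P$ have different colors. For a connected graph $G$, the $(1,2)$-proper connection number $pc_{1,2}(G)$ is the minimum number of colors in an edge-coloring of $G$ such that every two distinct vertices of $G$ are joined by a distance $2$-proper path in $G$. The condition $\operatorname{diam}(\overline{G})=2$ includes that $\overline{G}$ is connected. *)

theory Defs
  imports "Graph_Theory.Graph_Theory"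
begin

text \<open>
  A finite simple undirected graph is a \<open>pair_graph\<close>: a finite, loop-free digraph without
  parallel arcs whose arc relation is symmetric.  An undirected edge is the two-element set of
  the ends of a pair of opposite arcs; colors are attached to these sets, so that the two
  opposite arcs always share one color.
\<close>

definition uedges :: "'a pair_pre_digraph \<Rightarrow> 'a set set" where
  "uedges G = (\<lambda>(u, v). {u, v}) ` parcs G"

definition compl_graph :: "'a pair_pre_digraph \<Rightarrow> 'a pair_pre_digraph" where
  "compl_graph G = \<lparr> pverts = pverts G,
     parcs = {(u, v). u \<in> pverts G \<and> v \<in> pverts G \<and> u \<noteq> v \<and> (u, v) \<notin> parcs G} \<rparr>"

definition triangle_free :: "'a pair_pre_digraph \<Rightarrow> bool" where
  "triangle_free G \<longleftrightarrow>
     \<not> (\<exists>u v w. (u, v) \<in> parcs G \<and> (v, w) \<in> parcs G \<and> (w, u) \<in> parcs G)"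

text \<open>
  The distance is the library's shortest-path cost for unit weights, which is \<open>\<infinity>\<close> for vertices
  not joined by a walk.  Hence a finite diameter implies connectedness (the diameter of the null
  graph is \<open>-\<infinity>\<close>).
\<close>

definition gdist :: "'a pair_pre_digraph \<Rightarrow> 'a \<Rightarrow> 'a \<Rightarrow> ereal" where
  "gdist G u v = wf_digraph.\<mu> (with_proj G) (\<lambda>_. 1) u v"

definition diameter :: "'a pair_pre_digraph \<Rightarrow> ereal" where
  "diameter G = (SUP u\<in>pverts G. SUP v\<in>pverts G. gdist G u v)"

definition path_edges :: "'a vwalk \<Rightarrow> 'a set list" where
  "path_edges p = map (\<lambda>(u, v). {u, v}) (vwalk_arcs p)"

text \<open>Between the edges at positions \<open>i < j\<close> of a path there are \<open>j - i - 1\<close> further edges.\<close>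

definition dist2_proper_path :: "'a pair_pre_digraph \<Rightarrow> ('a set \<Rightarrow> 'c) \<Rightarrow> 'a vwalk \<Rightarrow> bool" where
  "dist2_proper_path G c p \<longleftrightarrow> vpath p (with_proj G) \<and>
     (\<forall>i j. i < j \<and> j < length (path_edges p) \<and> j - i - 1 < 2 \<longrightarrow>
        c (path_edges p ! i) \<noteq> c (path_edges p ! j))"

definition proper12_connected :: "'a pair_pre_digraph \<Rightarrow> ('a set \<Rightarrow> 'c) \<Rightarrow> bool" where
  "proper12_connected G c \<longleftrightarrow>
     (\<forall>u\<in>pverts G. \<forall>v\<in>pverts G. u \<noteq> v \<longrightarrow>
        (\<exists>p. dist2_proper_path G c p \<and> hd p = u \<and> last p = v))"

text \<open>
  Taking natural numbers as colors loses no generality, since only the finitely many edges of the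
  graph are colored; the values of \<open>c\<close> on sets that are not edges are irrelevant.  For a connected
  graph the minimum is attained, as shown below.
\<close>

definition pc12 :: "'a pair_pre_digraph \<Rightarrow> nat" where
  "pc12 G = (LEAST k. \<exists>c :: 'a set \<Rightarrow> nat. card (c ` uedges G) = k \<and> proper12_connected G c)"

lemma pair_graph_compl_graph:
  assumes "pair_graph G"
  shows "pair_graph (compl_graph G)"
proof -
  interpret pair_graph G by fact
  have "finite (parcs (compl_graph G))"
    by (rule finite_subset[of _ "pverts G \<times> pverts G"])
       (auto simp: compl_graph_def pair_finite_verts)
  moreover have "sym (parcs G)"
    using pair_sym_arcs by (simp add: symmetric_def)
  ultimately show ?thesis
    using pair_finite_verts
    by unfold_locales (auto simp: compl_graph_def symmetric_def sym_def)
qed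

lemma gdist_conv:
  assumes "pair_graph G"
  shows "gdist G u v = (INF p\<in>{p. pre_digraph.awalk (with_proj G) u p v}. ereal (real (length p)))"
proof -
  interpret pair_graph G by fact
  have "awalk_cost (\<lambda>_. 1) p = real (length p)" for p
    by (simp only: awalk_cost_def sum_list_triv map_replicate_const sum_list_replicate mult_1_right)
  then show ?thesis
    unfolding gdist_def \<mu>_def by (simp only:)
qed

lemma set_path_edges_subset: "e \<in> set (path_edges p) \<Longrightarrow> e \<subseteq> set p"
  by (induction p rule: vwalk_arcs.induct) (auto simp: path_edges_def)

lemma distinct_path_edges: "distinct p \<Longrightarrow> distinct (path_edges p)"
proof (induction p rule: vwalk_arcs.induct)
  case (3 x y xs)
  then have "{x, y} \<notin> set (path_edges (y # xs))"
    using set_path_edges_subset[of "{x, y}" "y # xs"] by auto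
  with 3 show ?case by (auto simp: path_edges_def)
qed (auto simp: path_edges_def)

lemma reachable_imp_vpath:
  assumes "(u, v) \<in> rtrancl_on (verts G) (arcs_ends G)"
  shows "\<exists>p. vpath p G \<and> hd p = u \<and> last p = v"
  using assms
proof (induction rule: converse_rtrancl_on_induct)
  case base
  then show ?case
    by (intro exI[of _ "[v]"]) (auto simp: vpath_def vwalk_def)
next
  case (step y z)
  then obtain p where p: "vpath p G" "hd p = z" "last p = v" by blast
  then have "p \<noteq> []" by (auto simp: vpath_def vwalk_def)
  show ?case
  proof (cases "y \<in> set p")
    case False
    with p step \<open>p \<noteq> []\<close> show ?thesis
      by (intro exI[of _ "y # p"]) (auto simp: vpath_def intro: vwalk_consI)
  next
    case True
    then obtain xs ys where xs: "p = xs @ y # ys" by (meson split_list)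
    have "set (vwalk_arcs (y # ys)) \<subseteq> set (vwalk_arcs (xs @ y # ys))"
      by (induction xs rule: vwalk_arcs.induct) auto
    with p xs show ?thesis
      by (intro exI[of _ "y # ys"]) (auto simp: vpath_def vwalk_def)
  qed
qed

lemma inj_coloring_dist2_proper_path:
  assumes c: "inj_on c (uedges G)" and p: "vpath p (with_proj G)"
  shows "dist2_proper_path G c p"
proof -
  have "set (vwalk_arcs p) \<subseteq> parcs G" and "distinct p"
    using p by (simp_all add: vpath_def vwalk_def)
  then have sub: "set (path_edges p) \<subseteq> uedges G"
    unfolding path_edges_def uedges_def set_map by (intro image_mono)
  have dist: "distinct (path_edges p)"
    using \<open>distinct p\<close> by (rule distinct_path_edges)
  have "c (path_edges p ! i) \<noteq> c (path_edges p ! j)"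
    if ij: "i < j" "j < length (path_edges p)" for i j
  proof
    assume "c (path_edges p ! i) = c (path_edges p ! j)"
    moreover have "path_edges p ! i \<in> uedges G" "path_edges p ! j \<in> uedges G"
      using sub nth_mem[of i "path_edges p"] nth_mem[of j "path_edges p"] ij by auto
    ultimately have "path_edges p ! i = path_edges p ! j"
      by (rule inj_onD[OF c])
    with dist ij show False
      by (simp add: nth_eq_iff_index_eq)
  qed
  with p show ?thesis
    unfolding dist2_proper_path_def by blast
qed

lemma pc12_attained:
  fixes G :: "'a pair_pre_digraph"
  assumes "pair_graph G" "Digraph_Component.connected (with_proj G)"
  shows "\<exists>c :: 'a set \<Rightarrow> nat. card (c ` uedges G) = pc12 G \<and> proper12_connected G c"
proof -
  have "finite (uedges G)"
    unfolding uedges_def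
    by (rule finite_imageI[OF pair_fin_digraph.pair_finite_arcs])
       (rule pair_pseudo_graph.axioms(1)[OF pair_graph.axioms(2)[OF assms(1)]])
  then obtain c :: "'a set \<Rightarrow> nat" where c: "inj_on c (uedges G)"
    using finite_imp_inj_to_nat_seg by metis
  have sym: "pair_sym_digraph G"
    by (rule pair_pseudo_graph.axioms(2)[OF pair_graph.axioms(2)[OF assms(1)]])
  have sc: "strongly_connected (with_proj G)"
  proof -
    interpret pair_sym_digraph G by (rule sym)
    show ?thesis
      by (rule symmetric_connected_imp_strongly_connected[OF pair_sym_arcs assms(2)])
  qed
  have "proper12_connected G c"
    unfolding proper12_connected_def
  proof (intro ballI impI)
    fix u v assume "u \<in> pverts G" "v \<in> pverts G"
    then have "(u, v) \<in> rtrancl_on (verts (with_proj G)) (arcs_ends (with_proj G))"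
      using sc unfolding strongly_connected_def reachable_def with_proj_simps by blast
    from reachable_imp_vpath[OF this] obtain p
      where "vpath p (with_proj G)" "hd p = u" "last p = v" by blast
    with inj_coloring_dist2_proper_path[OF c]
    show "\<exists>p. dist2_proper_path G c p \<and> hd p = u \<and> last p = v" by blast
  qed
  then have "\<exists>k. \<exists>c :: 'a set \<Rightarrow> nat. card (c ` uedges G) = k \<and> proper12_connected G c"
    by blast
  then show ?thesis
    unfolding pc12_def by (rule LeastI_ex)
qed

end

theory Submission
  imports Defs
begin

text \<open>
  Let \<open>H\<close> be the complement of \<open>G\<close>. Some edge \<open>uv\<close> of \<open>H\<close> has a common \<open>G\<close>-neighbour \<open>w\<close>:
  otherwise \<open>V\<close> is the union of the \<open>H\<close>-independent sets \<open>N\<^sub>H(u)\<close> and \<open>N\<^sub>H(v)\<close>, and a \<open>G\<close>-edge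
  between them, which exists because \<open>G\<close> is connected, contradicts diameter 2.
  Give \<open>uw\<close> and \<open>vw\<close> two private colors and all other edges a third color. Since \<open>H\<close> has no
  triangle through \<open>uv\<close>, every other vertex is \<open>G\<close>-adjacent to \<open>u\<close> or \<open>v\<close>; and if \<open>s\<close>, \<open>t\<close> are
  \<open>H\<close>-adjacent, triangle-freeness makes one of \<open>s-u-w-v-t\<close> and \<open>t-u-w-v-s\<close> a path of \<open>G\<close>, with
  color pattern \<open>0,1,2,0\<close>.
\<close>

lemma compl_graph_arc_iff:
  "(x, y) \<in> parcs (compl_graph G) \<longleftrightarrow>
     x \<in> pverts G \<and> y \<in> pverts G \<and> x \<noteq> y \<and> (x, y) \<notin> parcs G"
  by (simp add: compl_graph_def)

lemma pair_graph_arcD: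
  assumes "pair_graph G" "(x, y) \<in> parcs G"
  shows "(y, x) \<in> parcs G" "x \<in> pverts G" "y \<in> pverts G" "x \<noteq> y"
proof -
  interpret pair_graph G by fact
  have "sym (parcs G)"
    using pair_sym_arcs by (simp add: symmetric_def)
  then show "(y, x) \<in> parcs G"
    using assms(2) by (rule symD)
  show "x \<in> pverts G" "y \<in> pverts G"
    using assms(2) wellformed by fastforce+
  show "x \<noteq> y"
    using assms(2) pair_no_loops by fastforce
qed

lemma gdist_lessE:
  assumes "pair_graph G" "gdist G u v < b"
  obtains p where "pre_digraph.awalk (with_proj G) u p v" "ereal (real (length p)) < b"
  using assms(2) unfolding gdist_conv[OF assms(1)] INF_less_iff by auto

lemma gdist_le_length:
  assumes "pair_graph G" "pre_digraph.awalk (with_proj G) u p v"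
  shows "gdist G u v \<le> ereal (real (length p))"
  unfolding gdist_conv[OF assms(1)] using assms(2) by (intro INF_lower) simp

lemma gdist_le_diameter:
  assumes "u \<in> pverts G" "v \<in> pverts G"
  shows "gdist G u v \<le> diameter G"
  unfolding diameter_def using assms by (meson SUP_upper SUP_upper2)

lemma common_neighbour_of_diameter_two:
  assumes G: "pair_graph G" and "diameter G = 2"
    and "u \<in> pverts G" "v \<in> pverts G" "u \<noteq> v" "(u, v) \<notin> parcs G"
  obtains z where "(u, z) \<in> parcs G" "(z, v) \<in> parcs G"
proof -
  have "gdist G u v \<le> 2"
    using gdist_le_diameter[of u G v] assms by simp
  \<comment> \<open>The distance is an infimum, so a walk is read off from a strict bound; lengths
    are integers, hence below \<open>3\<close> means at most \<open>2\<close>.\<close>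
  also have "(2 :: ereal) < ereal 3"
    by simp
  finally obtain p where p: "pre_digraph.awalk (with_proj G) u p v" "real (length p) < 3"
    using gdist_lessE[OF G] by (metis less_ereal.simps(1))
  interpret pair_graph G by fact
  have "length p = 0 \<or> length p = 1 \<or> length p = 2"
    using p(2) by linarith
  then consider "p = []" | e where "p = [e]" | e f where "p = [e, f]"
    by (auto simp: length_Suc_conv numeral_2_eq_2)
  then show thesis
  proof cases
    case 3
    with p(1) show thesis
      by (cases e; cases f) (auto simp: awalk_def intro: that)
  qed (use p(1) assms in \<open>auto simp: awalk_def\<close>)
qed

text \<open>A positive supremum yields two vertices at positive distance, distinct because the empty
  walk has length 0. Either they are adjacent or their common neighbour supplies the arc.\<close>

lemma arc_of_diameter_two:
  assumes G: "pair_graph G" and diam: "diameter G = 2"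
  obtains u v where "(u, v) \<in> parcs G"
proof -
  have "0 < diameter G"
    using diam by simp
  then obtain u v where uv: "u \<in> pverts G" "v \<in> pverts G" "0 < gdist G u v"
    unfolding diameter_def less_SUP_iff by blast
  interpret pair_graph G by fact
  have "u \<noteq> v"
  proof
    assume "u = v"
    then have "awalk u [] v"
      using uv(1) by (simp add: awalk_def)
    from gdist_le_length[OF G this] uv(3) show False by (simp add: zero_ereal_def)
  qed
  with uv show thesis
    using common_neighbour_of_diameter_two[OF G diam] that by metis
qed

lemma connected_reachable:
  assumes "pair_graph G" "Digraph_Component.connected (with_proj G)"
    and "u \<in> pverts G" "v \<in> pverts G"
  shows "(u, v) \<in> rtrancl_on (pverts G) (parcs G)"
proof -
  interpret pair_graph G by fact
  have "strongly_connected (with_proj G)"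
    using symmetric_connected_imp_strongly_connected[OF pair_sym_arcs assms(2)] .
  then show ?thesis
    using assms(3,4) unfolding strongly_connected_def reachable_def by simp
qed

lemma ex_nonadjacent_with_common_neighbour:
  assumes G: "pair_graph G" and conn: "Digraph_Component.connected (with_proj G)"
    and tf: "triangle_free (compl_graph G)" and diam: "diameter (compl_graph G) = 2"
  obtains u v w where "u \<noteq> v" "(u, v) \<notin> parcs G" "(u, w) \<in> parcs G" "(w, v) \<in> parcs G"
proof -
  define H where "H = parcs (compl_graph G)"
  note GH = pair_graph_compl_graph[OF G]
  have H_iff: "(x, y) \<in> H \<longleftrightarrow> x \<in> pverts G \<and> y \<in> pverts G \<and> x \<noteq> y \<and> (x, y) \<notin> parcs G" for x y
    by (simp add: H_def compl_graph_arc_iff)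
  have H_sym: "(x, y) \<in> H \<Longrightarrow> (y, x) \<in> H" for x y
    unfolding H_def by (rule pair_graph_arcD[OF GH])
  have no_triangle: "(x, y) \<in> H \<Longrightarrow> (y, z) \<in> H \<Longrightarrow> (z, x) \<in> H \<Longrightarrow> False" for x y z
    using tf unfolding triangle_free_def H_def by blast
  obtain u v where uv: "(u, v) \<in> H"
    using arc_of_diameter_two[OF GH diam] unfolding H_def by metis
  have "\<exists>w. (u, w) \<in> parcs G \<and> (w, v) \<in> parcs G"
  proof (rule ccontr)
    assume none: "\<not> ?thesis"
    have cover: "(y, u) \<in> H \<or> (y, v) \<in> H" if "y \<in> pverts G" for y
      using none that uv by (metis H_iff H_sym pair_graph_arcD(1)[OF G])
    \<comment> \<open>If \<open>z\<close> left the \<open>H\<close>-neighbourhood of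
      \<open>v\<close>, it would be an \<open>H\<close>-neighbour of \<open>u\<close>, and a common
      \<open>H\<close>-neighbour \<open>t\<close> of \<open>y\<close> and \<open>z\<close> would
      close a triangle with \<open>z\<close>, \<open>u\<close> or with \<open>y\<close>,
      \<open>v\<close>.\<close>
    have step: "(z, v) \<in> H" if "(y, v) \<in> H" and yz: "(y, z) \<in> parcs G" for y z
    proof (rule ccontr)
      assume zv: "(z, v) \<notin> H"
      have z: "z \<in> pverts G" "y \<in> pverts G" "y \<noteq> z"
        using pair_graph_arcD[OF G yz] by auto
      then have zu: "(z, u) \<in> H"
        using cover zv by blast
      have "(y, z) \<notin> H"
        using yz by (simp add: H_iff)
      then obtain t where t: "(y, t) \<in> H" "(t, z) \<in> H"
        using common_neighbour_of_diameter_two[OF GH diam, of y z] z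
        unfolding H_def by (auto simp: compl_graph_def)
      have "t \<in> pverts G"
        using t by (simp add: H_iff)
      then consider "(t, u) \<in> H" | "(t, v) \<in> H"
        using cover by blast
      then show False
      proof cases
        case 1
        show ?thesis by (rule no_triangle[OF t(2) zu H_sym[OF 1]])
      next
        case 2
        show ?thesis by (rule no_triangle[OF t(1) 2 H_sym[OF \<open>(y, v) \<in> H\<close>]])
      qed
    qed
    \<comment> \<open>The invariant holds at \<open>u\<close>, and connectedness of \<open>G\<close>
      carries it to \<open>v\<close> itself, where it would be a loop.\<close>
    have "(x, v) \<in> H" if "(u, x) \<in> rtrancl_on (pverts G) (parcs G)" for x
      using that by (induction rule: rtrancl_on_induct) (use uv step in auto)
    moreover have "u \<in> pverts G" "v \<in> pverts G"
      using uv by (simp_all add: H_iff)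
    ultimately have "(v, v) \<in> H"
      using connected_reachable[OF G conn] by blast
    then show False
      by (simp add: H_iff)
  qed
  with uv show thesis
    using that by (auto simp: H_iff)
qed

lemma proper12_connected_spine:
  fixes c :: "'a set \<Rightarrow> nat"
  assumes G: "pair_graph G" and tf: "triangle_free (compl_graph G)"
    and uv: "u \<noteq> v" "(u, v) \<notin> parcs G" and w: "(u, w) \<in> parcs G" "(w, v) \<in> parcs G"
    and c: "c = (\<lambda>e. if e = {u, w} then 1 else if e = {w, v} then 2 else 0)"
  shows "proper12_connected G c"
proof -
  note arcD = pair_graph_arcD[OF G]
  have no_triangle:
    "(x, y) \<in> parcs G \<or> (y, z) \<in> parcs G \<or> (x, z) \<in> parcs G"
    if "x \<in> pverts G" "y \<in> pverts G" "z \<in> pverts G" "x \<noteq> y" "y \<noteq> z" "x \<noteq> z" for x y z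
    using tf that arcD(1) unfolding triangle_free_def compl_graph_arc_iff by metis
  have verts: "u \<in> pverts G" "v \<in> pverts G" "w \<in> pverts G" and ne: "u \<noteq> w" "w \<noteq> v"
    using arcD w by blast+
  define joined where
    "joined x y \<longleftrightarrow> (\<exists>p. dist2_proper_path G c p \<and> hd p = x \<and> last p = y)" for x y
  have path2: "joined x y" if "(x, y) \<in> parcs G" for x y
    unfolding joined_def
    by (rule exI[of _ "[x, y]"])
       (use that arcD[OF that] in \<open>auto simp: dist2_proper_path_def path_edges_def vpath_def vwalk_def\<close>)
  have path3: "joined x z"
    if "(x, y) \<in> parcs G" "(y, z) \<in> parcs G" "x \<noteq> z" "c {x, y} \<noteq> c {y, z}" for x y z
    unfolding joined_def
    by (rule exI[of _ "[x, y, z]"])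
       (use that arcD[OF that(1)] arcD[OF that(2)] in
         \<open>auto simp: dist2_proper_path_def path_edges_def vpath_def vwalk_def less_Suc_eq\<close>)
  have path4: "joined x t"
    if "(x, y) \<in> parcs G" "(y, z) \<in> parcs G" "(z, t) \<in> parcs G" "distinct [x, y, z, t]"
      "distinct [c {x, y}, c {y, z}, c {z, t}]" for x y z t
    unfolding joined_def
    by (rule exI[of _ "[x, y, z, t]"])
       (use that arcD[OF that(1)] arcD[OF that(2)] arcD[OF that(3)] in
         \<open>auto simp: dist2_proper_path_def path_edges_def vpath_def vwalk_def less_Suc_eq\<close>)
  \<comment> \<open>The two outer edges have two edges between them and may share a color, so only
    three consecutive edges need distinct colors.\<close>
  have path5: "joined x s"
    if "(x, y) \<in> parcs G" "(y, z) \<in> parcs G" "(z, t) \<in> parcs G" "(t, s) \<in> parcs G"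
      "distinct [x, y, z, t, s]" "distinct [c {x, y}, c {y, z}, c {z, t}]"
      "distinct [c {y, z}, c {z, t}, c {t, s}]" for x y z t s
    unfolding joined_def
    by (rule exI[of _ "[x, y, z, t, s]"])
       (use that arcD[OF that(1)] arcD[OF that(2)] arcD[OF that(3)] arcD[OF that(4)] in
         \<open>auto simp: dist2_proper_path_def path_edges_def vpath_def vwalk_def less_Suc_eq\<close>)
  have w': "(v, w) \<in> parcs G" "(w, u) \<in> parcs G"
    using w arcD(1) by blast+
  have col: "c {u, w} = 1" "c {w, u} = 1" "c {w, v} = 2" "c {v, w} = 2"
    using uv(1) ne unfolding c by (auto simp: doubleton_eq_iff)
  \<comment> \<open>Both special edges lie inside \<open>{u, v, w}\<close>.\<close>
  have col0: "c {x, y} = 0" "c {y, x} = 0" if "x \<notin> {u, v, w}" for x y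
    using that unfolding c by (auto simp: doubleton_eq_iff)
  have joined_uv: "joined u v" "joined v u"
    using path3[of u w v] path3[of v w u] w w' uv(1) col by auto
  have to_spine: "(s, u) \<in> parcs G \<or> (s, v) \<in> parcs G" if "s \<in> pverts G" "s \<notin> {u, v}" for s
    using no_triangle[of s u v] that verts uv by auto
  have joined_u: "joined s u \<and> joined u s" if s: "s \<in> pverts G" "s \<notin> {u, v, w}" for s
  proof (cases "(s, u) \<in> parcs G")
    case True
    then show ?thesis using path2 arcD(1) by blast
  next
    case False
    then have sv: "(s, v) \<in> parcs G" "(v, s) \<in> parcs G"
      using to_spine s arcD(1) by blast+
    \<comment> \<open>Enter at the far end \<open>v\<close> and cross both special edges: colors
      \<open>0\<close>, \<open>2\<close>, \<open>1\<close>, or the reverse.\<close>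
    show ?thesis
      using path4[of s v w u] path4[of u w v s] sv w w' s uv(1) ne col col0 by auto
  qed
  have joined_v: "joined s v \<and> joined v s" if s: "s \<in> pverts G" "s \<notin> {u, v, w}" for s
  proof (cases "(s, v) \<in> parcs G")
    case True
    then show ?thesis using path2 arcD(1) by blast
  next
    case False
    then have su: "(s, u) \<in> parcs G" "(u, s) \<in> parcs G"
      using to_spine s arcD(1) by blast+
    show ?thesis
      using path4[of s u w v] path4[of v w u s] su w w' s uv(1) ne col col0 by auto
  qed
  have joined_w: "joined s w \<and> joined w s" if s: "s \<in> pverts G" "s \<notin> {u, v, w}" for s
  proof -
    \<comment> \<open>Whichever end \<open>y\<close> is, the edge to \<open>s\<close> has color
      \<open>0\<close> and the edge to \<open>w\<close> has color \<open>1\<close> or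
      \<open>2\<close>.\<close>
    have *: ?thesis if "(s, y) \<in> parcs G" "y = u \<or> y = v" for y
      using path3[of s y w] path3[of w y s] that arcD(1)[OF that(1)] w w' s col col0 by auto
    show ?thesis
      using to_spine[of s] s * by blast
  qed
  have joined_rest: "joined s t"
    if s: "s \<in> pverts G" "s \<notin> {u, v, w}" and t: "t \<in> pverts G" "t \<notin> {u, v, w}" and "s \<noteq> t" for s t
  proof (cases "(s, t) \<in> parcs G")
    case True
    then show ?thesis by (rule path2)
  next
    case False
    \<comment> \<open>Each of \<open>s\<close>, \<open>t\<close> has a neighbour among
      \<open>u\<close>, \<open>v\<close>, and each of \<open>u\<close>, \<open>v\<close> has one
      among \<open>s\<close>, \<open>t\<close>; this forces a perfect matching.\<close>
    then have "((s, u) \<in> parcs G \<and> (t, v) \<in> parcs G) \<or> ((s, v) \<in> parcs G \<and> (t, u) \<in> parcs G)"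
      using to_spine[of s] to_spine[of t] no_triangle[of s t u] no_triangle[of s t v] s t verts
        \<open>s \<noteq> t\<close> by auto
    then show ?thesis
      using path5[of s u w v t] path5[of s v w u t] arcD(1) w w' s t \<open>s \<noteq> t\<close> uv(1) ne col col0
      by auto
  qed
  \<comment> \<open>Within \<open>{u, v, w}\<close> only \<open>u\<close> and \<open>v\<close> need
    a longer path; the other pairs are arcs.\<close>
  have "joined x y" if "x \<in> pverts G" "y \<in> pverts G" "x \<noteq> y" for x y
    using that joined_uv joined_u joined_v joined_w joined_rest path2 w w'
    by (cases "x \<in> {u, v, w}"; cases "y \<in> {u, v, w}") auto
  then show ?thesis
    unfolding proper12_connected_def joined_def by blast
qed

theorem theorem3p3:
  fixes G :: "'a pair_pre_digraph"
  assumes "pair_graph G"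
    and "Digraph_Component.connected (with_proj G)"
    and "triangle_free (compl_graph G)"
    and "diameter (compl_graph G) = 2"
  shows "pc12 G \<le> 3"
proof -
  obtain u v w where "u \<noteq> v" "(u, v) \<notin> parcs G" "(u, w) \<in> parcs G" "(w, v) \<in> parcs G"
    using ex_nonadjacent_with_common_neighbour[OF assms] .
  moreover define c :: "'a set \<Rightarrow> nat"
    where "c = (\<lambda>e. if e = {u, w} then 1 else if e = {w, v} then 2 else 0)"
  ultimately have "proper12_connected G c"
    using proper12_connected_spine[OF assms(1,3)] by blast
  \<comment> \<open>\<open>pc12\<close> counts the colors that occur on edges, so the size of the
    image is the bound to estimate.\<close>
  then have "pc12 G \<le> card (c ` uedges G)"
    unfolding pc12_def by (intro Least_le) blast
  also have "c ` uedges G \<subseteq> {0, 1, 2}"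
    by (auto simp: c_def)
  then have "card (c ` uedges G) \<le> card {0, 1, 2 :: nat}"
    by (intro card_mono) auto
  also have "\<dots> = 3"
    by simp
  finally show ?thesis .
qed

end
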